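(* Let $\{\gamma_t\}_{t=1}^{\infty}$ be a sequence of Borel probability measures on a Polish space $\mathcal{Y}$ and let $\gamma$ be another Borel probability measure on $\mathcal{Y}$. Let $h:\mathcal{Y}\times\mathcal{Y}\to\mathbb{R}$ be a symmetric measurable function. For each $t\ge 1$ and $n\ge 2$ let $Y_1^{(t)},\dots,Y_n^{(t)}$ be i.i.d. with law $\gamma_t$, and define $$U_n^{(t)}=\frac{1}{n(n-1)}\sum_{1\le i\neq j\le n}h\bigl(Y_i^{(t)},Y_j^{(t)}\bigr),\qquad \theta_t=\mathbb{E}_{(Y,Y')\sim\gamma_t\otimes\gamma_t}[h(Y,Y')],\qquad \theta=\mathbb{E}_{(Y,Y')\sim\gamma\otimes\gamma}[h(Y,Y')].$$ Let $\nu_t=\mathbb{E}_{(Y,Y')\sim\gamma_t\otimes\gamma_t}\bigl[|h(Y,Y')-\theta_t|^3\bigr]^{1/3}$ and assume $\limsup_{t\to\infty}\nu_t<\infty$. Assume that $\sigma_t^2=4\,\mathrm{Var}_{Y'\sim\gamma_t}\bigl[\mathbb{E}_{Y\sim\gamma_t}[h(Y,Y')]\bigr]$ converges to a constant $\sigma^2$ (with $\sigma\ge 0$) as $t\to\infty$, and that $\theta_t\to\theta$ as $t\to\infty$. Then, in the limit $n\to\infty$ with $t=t(n)\to\infty$ growing as a function of $n$ such that $\sqrt{n}\,(\theta_{t(n)}-\theta)\to 0$, the following hold: (i) if $\sigma>0$, then $\sqrt{n}\,\bigl(U_n^{(t)}-\theta\bigr)$ converges in distribution to $\mathcal{N}(0,\sigma^2)$;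 (ii) if $\sigma=0$, then $\sqrt{n}\,\bigl(U_n^{(t)}-\theta\bigr)\to 0$ in probability.
   Context: The expectations $\theta_t$ and $\theta$ are assumed to be well defined, i.e. $h$ is integrable with respect to $\gamma_t\otimes\gamma_t$ for each $t$ and with respect to $\gamma\otimes\gamma$. $\mathcal{N}(0,\sigma^2)$ is the centered normal distribution with variance $\sigma^2$. *)

theory Defs
  imports "HOL-Probability.Probability"
begin

definition kernel_mean :: "'a measure \<Rightarrow> ('a \<times> 'a \<Rightarrow> real) \<Rightarrow> real" where
  "kernel_mean \<mu> h = (\<integral>z. h z \<partial>(\<mu> \<Otimes>\<^sub>M \<mu>))"

text \<open>The centred third absolute moment need not be finite, so it is taken in \<^typ>\<open>ennreal\<close>,
  where an infinite moment yields \<open>\<infinity>\<close> and not the value \<open>0\<close> of a diverging Bochner integral.\<close>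

definition kernel_L3_dev :: "'a measure \<Rightarrow> ('a \<times> 'a \<Rightarrow> real) \<Rightarrow> ennreal" where
  "kernel_L3_dev \<mu> h =
     (let m = (\<integral>\<^sup>+z. ennreal (\<bar>h z - kernel_mean \<mu> h\<bar> ^ 3) \<partial>(\<mu> \<Otimes>\<^sub>M \<mu>))
      in if m = \<infinity> then \<infinity> else ennreal (enn2real m powr (1 / 3)))"

text \<open>The projection \<open>y' \<mapsto> E[h (Y, y')]\<close> is square integrable whenever
  \<^term>\<open>kernel_L3_dev \<mu> h < \<infinity>\<close>, so the real-valued variance below is then the true one.\<close>

definition U_asymp_var :: "'a measure \<Rightarrow> ('a \<times> 'a \<Rightarrow> real) \<Rightarrow> real" where
  "U_asymp_var \<mu> h = 4 * prob_space.variance \<mu> (\<lambda>y'. \<integral>y. h (y, y') \<partial>\<mu>)"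

definition U_stat :: "('a \<times> 'a \<Rightarrow> real) \<Rightarrow> nat \<Rightarrow> (nat \<Rightarrow> 'a) \<Rightarrow> real" where
  "U_stat h n y =
     1 / (real n * (real n - 1)) *
     (\<Sum>(i, j) \<in> {(i, j). i \<in> {1..n} \<and> j \<in> {1..n} \<and> i \<noteq> j}. h (y i, y j))"

text \<open>The underlying probability space may change along the sequence.\<close>

definition converges_in_prob ::
    "(nat \<Rightarrow> 'w measure) \<Rightarrow> (nat \<Rightarrow> 'w \<Rightarrow> real) \<Rightarrow> real \<Rightarrow> bool" where
  "converges_in_prob M X c \<longleftrightarrow>
     (\<forall>\<epsilon>>0. (\<lambda>n. measure (M n) {\<omega> \<in> space (M n). \<bar>X n \<omega> - c\<bar> > \<epsilon>}) \<longlonglongrightarrow> 0)"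

end

theory Submission
  imports Defs "HOL-Real_Asymp.Real_Asymp"
begin

text \<open>Write \<open>g y = E[h (Y, y)] - \<theta>\<close> and \<open>\<psi> (x, y) = h (x, y) - \<theta> - g x - g y\<close>. Hoeffding's decomposition is
  \<open>U\<^sub>n - \<theta> = 2 / n * (\<Sum>i. g Y\<^sub>i) + 1 / (n (n - 1)) * (\<Sum>i\<noteq>j. \<psi> (Y\<^sub>i, Y\<^sub>j))\<close>. The summands of the
  second part are orthogonal up to swapping \<open>i\<close> and \<open>j\<close>, so it has variance \<open>O (1 / n\<^sup>2)\<close>, and after
  scaling by \<open>sqrt n\<close> it vanishes in \<open>L\<^sup>2\<close>. The characteristic function of the first part is compared
  with \<open>(1 - u\<^sup>2 \<sigma>\<^sup>2 / (2 n))\<^sup>n\<close> by a third-order Taylor bound. All bounds depend on the law only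
  through the third moment and \<open>\<sigma>\<^sub>t\<^sup>2\<close>, so they are uniform along \<open>t (n)\<close>, and Levy's continuity theorem
  applies. For \<open>\<sigma> = 0\<close> Chebyshev's inequality suffices.\<close>

subsection \<open>Moments and characteristic functions\<close>

definition off_diagonal :: "nat \<Rightarrow> (nat \<times> nat) set" where
  "off_diagonal n = {(i, j). i \<in> {1..n} \<and> j \<in> {1..n} \<and> i \<noteq> j}"

lemma off_diagonal_eq_Sigma: "off_diagonal n = (SIGMA i:{1..n}. {1..n} - {i})"
  by (auto simp: off_diagonal_def)

lemma finite_off_diagonal [simp]: "finite (off_diagonal n)"
  by (simp add: off_diagonal_eq_Sigma)

lemma card_off_diagonal: "real (card (off_diagonal n)) = real n * (real n - 1)"
  by (cases n) (simp_all add: off_diagonal_eq_Sigma algebra_simps)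

lemma sum_off_diagonal_fst:
  "(\<Sum>(i, j)\<in>off_diagonal n. f i) = (real n - 1) * (\<Sum>i\<in>{1..n}. f i)"
  by (cases n) (simp_all add: off_diagonal_eq_Sigma sum.Sigma[symmetric] sum_distrib_left algebra_simps)

lemma sum_off_diagonal_swap:
  "(\<Sum>(i, j)\<in>off_diagonal n. f i j) = (\<Sum>(i, j)\<in>off_diagonal n. f j i)"
  by (rule sum.reindex_bij_witness[of _ prod.swap prod.swap]) (auto simp: off_diagonal_def)

lemma sum_off_diagonal_add:
  fixes f :: "nat \<Rightarrow> real"
  shows "(\<Sum>(i, j)\<in>off_diagonal n. f i + f j) = 2 * (real n - 1) * (\<Sum>i\<in>{1..n}. f i)"
  using sum_off_diagonal_fst[of f n] sum_off_diagonal_swap[of "\<lambda>i j. f i" n]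
  by (simp add: case_prod_unfold sum.distrib algebra_simps)

lemma U_stat_restrict: "U_stat h n (restrict y {1..n}) = U_stat h n y"
  unfolding U_stat_def by (intro arg_cong2[where f="(*)"] refl sum.cong) auto

lemma square_le_one_plus_cube: "(x::real)\<^sup>2 \<le> 1 + \<bar>x\<bar> ^ 3"
proof (cases "\<bar>x\<bar> \<le> 1")
  case True
  then have "x\<^sup>2 \<le> 1" by (simp add: abs_square_le_1)
  moreover have "0 \<le> \<bar>x\<bar> ^ 3" by simp
  ultimately show ?thesis by linarith
next
  case False
  then have "\<bar>x\<bar> ^ 2 \<le> \<bar>x\<bar> ^ 3" by (intro power_increasing) auto
  then show ?thesis by simp
qed

lemma cube_tangent:
  fixes a c :: real
  assumes "0 \<le> a" "0 \<le> c"
  shows "3 * c\<^sup>2 * a - 2 * c ^ 3 \<le> a ^ 3"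
proof -
  have "0 \<le> (a - c)\<^sup>2 * (a + 2 * c)" using assms by simp
  also have "\<dots> = a ^ 3 - (3 * c\<^sup>2 * a - 2 * c ^ 3)"
    by (simp add: power2_eq_square power3_eq_cube algebra_simps)
  finally show ?thesis by simp
qed

lemma (in prob_space) integrable_square_of_cube:
  fixes f :: "'a \<Rightarrow> real"
  assumes [measurable]: "f \<in> borel_measurable M" and "integrable M (\<lambda>x. \<bar>f x\<bar> ^ 3)"
  shows "integrable M (\<lambda>x. (f x)\<^sup>2)"
    and "(\<integral>x. (f x)\<^sup>2 \<partial>M) \<le> 1 + (\<integral>x. \<bar>f x\<bar> ^ 3 \<partial>M)"
proof -
  have i: "integrable M (\<lambda>x. 1 + \<bar>f x\<bar> ^ 3)" using assms by simp
  show *: "integrable M (\<lambda>x. (f x)\<^sup>2)"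
    by (rule Bochner_Integration.integrable_bound[OF i]) (use square_le_one_plus_cube in \<open>auto intro!: AE_I2\<close>)
  have "(\<integral>x. (f x)\<^sup>2 \<partial>M) \<le> (\<integral>x. 1 + \<bar>f x\<bar> ^ 3 \<partial>M)"
    by (rule integral_mono[OF * i]) (rule square_le_one_plus_cube)
  also have "\<dots> = 1 + (\<integral>x. \<bar>f x\<bar> ^ 3 \<partial>M)" using assms by (simp add: prob_space)
  finally show "(\<integral>x. (f x)\<^sup>2 \<partial>M) \<le> 1 + (\<integral>x. \<bar>f x\<bar> ^ 3 \<partial>M)" .
qed

lemma (in prob_space) abs_expectation_cube_le:
  fixes f :: "'a \<Rightarrow> real"
  assumes "integrable M f" "integrable M (\<lambda>x. \<bar>f x\<bar> ^ 3)"
  shows "\<bar>expectation f\<bar> ^ 3 \<le> expectation (\<lambda>x. \<bar>f x\<bar> ^ 3)"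
proof -
  define c where "c = expectation (\<lambda>x. \<bar>f x\<bar>)"
  have c: "0 \<le> c" "\<bar>expectation f\<bar> \<le> c"
    unfolding c_def using integral_norm_bound[of M f] by auto
  have "c ^ 3 = expectation (\<lambda>x. 3 * c\<^sup>2 * \<bar>f x\<bar> - 2 * c ^ 3)"
    using assms by (simp add: prob_space c_def[symmetric]) (simp add: power2_eq_square power3_eq_cube)
  also have "\<dots> \<le> expectation (\<lambda>x. \<bar>f x\<bar> ^ 3)"
    using assms by (intro integral_mono cube_tangent c) auto
  finally show ?thesis using c by (meson abs_ge_zero order_trans power_mono)
qed

lemma integrable_mult_of_squares:
  fixes f g :: "'a \<Rightarrow> real"
  assumes [measurable]: "f \<in> borel_measurable M" "g \<in> borel_measurable M"
    and "integrable M (\<lambda>x. (f x)\<^sup>2)" "integrable M (\<lambda>x. (g x)\<^sup>2)"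
  shows "integrable M (\<lambda>x. f x * g x)"
proof (rule Bochner_Integration.integrable_bound[of _ "\<lambda>x. (f x)\<^sup>2 + (g x)\<^sup>2"])
  have "\<bar>a * b\<bar> \<le> a\<^sup>2 + b\<^sup>2" for a b :: real
  proof -
    have "0 \<le> (a - b)\<^sup>2" "0 \<le> (a + b)\<^sup>2" "0 \<le> a\<^sup>2 + b\<^sup>2" by simp_all
    then have "2 * (a * b) \<le> a\<^sup>2 + b\<^sup>2" "- (2 * (a * b)) \<le> a\<^sup>2 + b\<^sup>2" "0 \<le> a\<^sup>2 + b\<^sup>2"
      unfolding power2_diff power2_sum by linarith+
    then show ?thesis by linarith
  qed
  then show "AE x in M. norm (f x * g x) \<le> norm ((f x)\<^sup>2 + (g x)\<^sup>2)" by auto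
qed (use assms in auto)

lemma expectation_square_sum:
  fixes F :: "'i \<Rightarrow> 'a \<Rightarrow> real"
  assumes "\<And>p. p \<in> I \<Longrightarrow> F p \<in> borel_measurable M"
    and "\<And>p. p \<in> I \<Longrightarrow> integrable M (\<lambda>x. (F p x)\<^sup>2)"
  shows "integrable M (\<lambda>x. (\<Sum>p\<in>I. F p x)\<^sup>2)"
    and "(\<integral>x. (\<Sum>p\<in>I. F p x)\<^sup>2 \<partial>M) = (\<Sum>p\<in>I. \<Sum>q\<in>I. \<integral>x. F p x * F q x \<partial>M)"
proof -
  have eq: "(\<Sum>p\<in>I. F p x)\<^sup>2 = (\<Sum>p\<in>I. \<Sum>q\<in>I. F p x * F q x)" for x
    by (simp add: power2_eq_square sum_product)
  have i: "integrable M (\<lambda>x. F p x * F q x)" if "p \<in> I" "q \<in> I" for p q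
    using that assms by (intro integrable_mult_of_squares) auto
  show "integrable M (\<lambda>x. (\<Sum>p\<in>I. F p x)\<^sup>2)"
    unfolding eq by (intro Bochner_Integration.integrable_sum i)
  show "(\<integral>x. (\<Sum>p\<in>I. F p x)\<^sup>2 \<partial>M) = (\<Sum>p\<in>I. \<Sum>q\<in>I. \<integral>x. F p x * F q x \<partial>M)"
    unfolding eq by (simp add: i)
qed

lemma (in prob_space) abs_expectation_le_sqrt:
  fixes X :: "'a \<Rightarrow> real"
  assumes [measurable]: "random_variable borel X" and "integrable M (\<lambda>x. (X x)\<^sup>2)"
  shows "expectation (\<lambda>x. \<bar>X x\<bar>) \<le> sqrt (expectation (\<lambda>x. (X x)\<^sup>2))"
proof -
  have i: "integrable M (\<lambda>x. \<bar>X x\<bar>)"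
    using square_integrable_imp_integrable[OF assms] by simp
  have "0 \<le> variance (\<lambda>x. \<bar>X x\<bar>)" by simp
  also have "\<dots> = expectation (\<lambda>x. (X x)\<^sup>2) - (expectation (\<lambda>x. \<bar>X x\<bar>))\<^sup>2"
    using assms i by (subst variance_eq) auto
  finally show ?thesis by (intro real_le_rsqrt) simp
qed

lemma (in prob_space) char_distr_add_diff_le:
  fixes X Z :: "'a \<Rightarrow> real"
  assumes [measurable]: "random_variable borel X" and Z: "integrable M Z"
  shows "cmod (char (distr M borel (\<lambda>\<omega>. X \<omega> + Z \<omega>)) t - char (distr M borel X) t)
    \<le> \<bar>t\<bar> * expectation (\<lambda>\<omega>. \<bar>Z \<omega>\<bar>)"
proof -
  note [measurable] = borel_measurable_integrable[OF Z]
  have i: "integrable M (\<lambda>x. iexp (t * (X x + Z x)))" "integrable M (\<lambda>x. iexp (t * X x))"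
    by (auto intro!: integrable_iexp)
  have b: "cmod (iexp (t * (X x + Z x)) - iexp (t * X x)) \<le> \<bar>t\<bar> * \<bar>Z x\<bar>" for x
  proof -
    have "iexp (t * (X x + Z x)) - iexp (t * X x) = iexp (t * X x) * (iexp (t * Z x) - 1)"
      by (simp add: algebra_simps exp_add)
    moreover have "cmod (iexp (t * Z x) - 1) \<le> \<bar>t * Z x\<bar>"
      using iexp_approx1[of "t * Z x" 0] by simp
    ultimately show ?thesis by (simp add: norm_mult abs_mult)
  qed
  have "char (distr M borel (\<lambda>\<omega>. X \<omega> + Z \<omega>)) t - char (distr M borel X) t
    = (CLINT x|M. iexp (t * (X x + Z x)) - iexp (t * X x))"
    using i by (simp add: char_def integral_distr)
  also have "cmod \<dots> \<le> expectation (\<lambda>x. cmod (iexp (t * (X x + Z x)) - iexp (t * X x)))"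
    by (rule integral_norm_bound)
  also have "\<dots> \<le> expectation (\<lambda>x. \<bar>t\<bar> * \<bar>Z x\<bar>)"
    using i Z by (intro integral_mono b) auto
  finally show ?thesis by simp
qed

lemma char_normal_distribution:
  assumes "\<sigma> > 0"
  shows "char (density lborel (normal_density 0 \<sigma>)) t = complex_of_real (exp (- (\<sigma>\<^sup>2 * t\<^sup>2) / 2))"
proof -
  interpret prob_space std_normal_distribution by (rule prob_space_normal_density) simp
  have "distributed std_normal_distribution lborel (\<lambda>x. x) (normal_density 0 1)"
    by (auto simp: distributed_def distr_id2)
  from normal_density_affine[OF this, of \<sigma> 0] assms
  have "distributed std_normal_distribution lborel (\<lambda>x. \<sigma> * x) (normal_density 0 \<sigma>)"
    by simp
  then have eq: "density lborel (normal_density 0 \<sigma>) = distr std_normal_distribution lborel (\<lambda>x. \<sigma> * x)"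
    by (simp add: distributed_def)
  have "char (density lborel (normal_density 0 \<sigma>)) t = char std_normal_distribution (\<sigma> * t)"
    unfolding eq char_def by (subst integral_distr) (auto simp: ac_simps)
  then show ?thesis by (simp add: char_std_normal_distribution power_mult_distrib)
qed

lemma (in prob_space) integral_PiM_eq_0:
  fixes F :: "('i \<Rightarrow> 'a) \<Rightarrow> real"
  assumes "finite I" "k \<in> I" "integrable (\<Pi>\<^sub>M i\<in>I. M) F"
    and "\<And>x. (\<integral>y. F (x(k := y)) \<partial>M) = 0"
  shows "(\<integral>x. F x \<partial>(\<Pi>\<^sub>M i\<in>I. M)) = 0"
proof -
  interpret product_sigma_finite "\<lambda>_::'i. M" ..
  have eq: "insert k (I - {k}) = I" using assms(2) by auto
  have "(\<integral>x. F x \<partial>(\<Pi>\<^sub>M i\<in>I. M)) = (\<integral>x. (\<integral>y. F (x(k := y)) \<partial>M) \<partial>(\<Pi>\<^sub>M i\<in>I - {k}. M))"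
    using product_integral_insert[of "I - {k}" k F] assms(1,3) unfolding eq by simp
  then show ?thesis by (simp add: assms(4))
qed

lemma (in prob_space) distr_PiM_coordinate:
  "i \<in> I \<Longrightarrow> distr (\<Pi>\<^sub>M i\<in>I. M) M (\<lambda>x. x i) = M"
  by (rule distr_PiM_component) (auto intro: prob_space_axioms)

lemma (in prob_space) indep_vars_PiM_coordinates:
  assumes "I \<noteq> {}"
  shows "prob_space.indep_vars (\<Pi>\<^sub>M i\<in>I. M) (\<lambda>_. M) (\<lambda>i x. x i) I"
proof -
  let ?P = "\<Pi>\<^sub>M i\<in>I. M"
  interpret P: prob_space ?P by (intro prob_space_PiM prob_space_axioms)
  have "distr ?P ?P (\<lambda>x. \<lambda>i\<in>I. x i) = distr ?P ?P (\<lambda>x. x)"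
    by (intro distr_cong) (auto simp: space_PiM restrict_PiE_iff PiE_restrict)
  also have "\<dots> = (\<Pi>\<^sub>M i\<in>I. distr ?P M (\<lambda>x. x i))"
    by (simp add: distr_id2 distr_PiM_coordinate cong: PiM_cong)
  finally show ?thesis
    using assms by (subst P.indep_vars_iff_distr_eq_PiM') auto
qed

lemma (in prob_space) distr_PiM_coordinate_pair:
  assumes "i \<in> I" "j \<in> I" "i \<noteq> j"
  shows "distr (\<Pi>\<^sub>M i\<in>I. M) (M \<Otimes>\<^sub>M M) (\<lambda>x. (x i, x j)) = M \<Otimes>\<^sub>M M"
proof -
  let ?P = "\<Pi>\<^sub>M i\<in>I. M"
  interpret P: prob_space ?P by (intro prob_space_PiM prob_space_axioms)
  have ind: "P.indep_vars (\<lambda>_. M) (\<lambda>i x. x i) I"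
    using assms by (intro indep_vars_PiM_coordinates) auto
  have "P.indep_var M ((\<lambda>f. f i) \<circ> (\<lambda>x. \<lambda>i\<in>{i}. x i)) M ((\<lambda>f. f j) \<circ> (\<lambda>x. \<lambda>i\<in>{j}. x i))"
    using assms by (intro P.indep_var_compose[OF P.indep_var_restrict[OF ind]]) auto
  then have "P.indep_var M (\<lambda>x. x i) M (\<lambda>x. x j)" by (simp add: comp_def)
  then show ?thesis
    using assms by (simp add: P.indep_var_distribution_eq distr_PiM_coordinate)
qed

lemma levy_continuity_eventually:
  assumes real_distr: "\<forall>\<^sub>F n in sequentially. real_distribution (M n)"
    and M': "real_distribution M'"
    and conv: "\<And>t. (\<lambda>n. char (M n) t) \<longlonglongrightarrow> char M' t"
  shows "weak_conv_m M M'"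
proof -
  obtain N where N: "\<And>n. n \<ge> N \<Longrightarrow> real_distribution (M n)"
    using real_distr unfolding eventually_sequentially by auto
  have "weak_conv_m (\<lambda>n. M (n + N)) M'"
    using conv by (intro levy_continuity M' N LIMSEQ_ignore_initial_segment) auto
  then show ?thesis
    unfolding weak_conv_m_def weak_conv_def by (auto dest: LIMSEQ_offset)
qed

lemma kernel_L3_dev_bound:
  assumes "h \<in> borel_measurable (M \<Otimes>\<^sub>M M)" "kernel_L3_dev M h < ennreal B"
  shows "integrable (M \<Otimes>\<^sub>M M) (\<lambda>z. \<bar>h z - kernel_mean M h\<bar> ^ 3)"
    and "(\<integral>z. \<bar>h z - kernel_mean M h\<bar> ^ 3 \<partial>(M \<Otimes>\<^sub>M M)) \<le> B ^ 3"
proof -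
  note [measurable] = assms(1)
  let ?f = "\<lambda>z. \<bar>h z - kernel_mean M h\<bar> ^ 3"
  define m where "m = (\<integral>\<^sup>+z. ennreal (?f z) \<partial>(M \<Otimes>\<^sub>M M))"
  have fin: "m \<noteq> \<infinity>" and lt: "ennreal (enn2real m powr (1 / 3)) < ennreal B"
    using assms(2) unfolding kernel_L3_dev_def Let_def m_def[symmetric] by (auto split: if_splits)
  show "integrable (M \<Otimes>\<^sub>M M) ?f"
    using fin unfolding m_def by (intro integrableI_bounded) (auto simp: less_top)
  have "(\<integral>z. ?f z \<partial>(M \<Otimes>\<^sub>M M)) = enn2real m"
    unfolding m_def by (rule integral_eq_nn_integral) auto
  also have "enn2real m = (enn2real m powr (1 / 3)) ^ 3"
    by (cases "enn2real m = 0") (simp_all add: powr_power)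
  also have "\<dots> \<le> B ^ 3"
    using lt by (intro power_mono) (auto simp: ennreal_less_iff)
  finally show "(\<integral>z. ?f z \<partial>(M \<Otimes>\<^sub>M M)) \<le> B ^ 3" .
qed

lemma (in prob_space) distr_indep_vars_identical:
  assumes "indep_vars (\<lambda>_. N) Y I" "I \<noteq> {}" "\<And>i. i \<in> I \<Longrightarrow> distr M N (Y i) = K"
    and "F \<in> (\<Pi>\<^sub>M i\<in>I. K) \<rightarrow>\<^sub>M L"
    and "\<And>y. F (restrict y I) = F y"
  shows "distr M L (\<lambda>\<omega>. F (\<lambda>i. Y i \<omega>)) = distr (\<Pi>\<^sub>M i\<in>I. K) L F"
    and "(\<lambda>\<omega>. F (\<lambda>i. Y i \<omega>)) \<in> M \<rightarrow>\<^sub>M L"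
proof -
  let ?R = "\<lambda>\<omega>. \<lambda>i\<in>I. Y i \<omega>"
  have rv: "random_variable N (Y i)" if "i \<in> I" for i
    using assms(1) that by (auto simp: indep_vars_def)
  have sets: "sets N = sets K"
  proof -
    obtain i where "i \<in> I" using assms(2) by auto
    then show ?thesis using sets_distr[of M N "Y i"] assms(3) by simp
  qed
  have R: "?R \<in> M \<rightarrow>\<^sub>M (\<Pi>\<^sub>M i\<in>I. N)" using rv by measurable
  have L: "F \<in> (\<Pi>\<^sub>M i\<in>I. N) \<rightarrow>\<^sub>M L"
    using assms(4) measurable_cong_sets[OF sets_PiM_cong[OF refl sets] refl, of I] by auto
  have eq: "(\<lambda>\<omega>. F (\<lambda>i. Y i \<omega>)) = F \<circ> ?R" using assms(5) by (auto simp: fun_eq_iff)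
  show "(\<lambda>\<omega>. F (\<lambda>i. Y i \<omega>)) \<in> M \<rightarrow>\<^sub>M L"
    unfolding eq using R L by (rule measurable_comp)
  have "distr M (\<Pi>\<^sub>M i\<in>I. N) ?R = (\<Pi>\<^sub>M i\<in>I. distr M N (Y i))"
    using assms(1) indep_vars_iff_distr_eq_PiM'[OF assms(2), where M'="\<lambda>_. N" and X=Y] rv by auto
  also have "\<dots> = (\<Pi>\<^sub>M i\<in>I. K)" by (intro PiM_cong refl assms(3))
  finally have "distr M (\<Pi>\<^sub>M i\<in>I. N) ?R = (\<Pi>\<^sub>M i\<in>I. K)" .
  then show "distr M L (\<lambda>\<omega>. F (\<lambda>i. Y i \<omega>)) = distr (\<Pi>\<^sub>M i\<in>I. K) L F"
    unfolding eq using distr_distr[OF L R] by simp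
qed

subsection \<open>Hoeffding's decomposition\<close>

locale symmetric_kernel = prob_space M for M :: "'a measure" +
  fixes h :: "'a \<times> 'a \<Rightarrow> real"
  assumes h_measurable [measurable]: "h \<in> borel_measurable (M \<Otimes>\<^sub>M M)"
    and h_sym: "h (x, y) = h (y, x)"
    and h_integrable: "integrable (M \<Otimes>\<^sub>M M) h"
    and h_cube_integrable: "integrable (M \<Otimes>\<^sub>M M) (\<lambda>z. \<bar>h z - kernel_mean M h\<bar> ^ 3)"
begin

sublocale MM: pair_prob_space M M ..

abbreviation "\<theta> \<equiv> kernel_mean M h"

definition third_moment :: real where
  "third_moment = (\<integral>z. \<bar>h z - \<theta>\<bar> ^ 3 \<partial>(M \<Otimes>\<^sub>M M))"

definition projection :: "'a \<Rightarrow> real" where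
  "projection y = (\<integral>y'. h (y', y) \<partial>M) - \<theta>"

definition degenerate_part :: "'a \<Rightarrow> 'a \<Rightarrow> real" where
  "degenerate_part x y = h (x, y) - \<theta> - projection x - projection y"

lemma projection_altdef: "projection y = (\<integral>y'. h (y, y') \<partial>M) - \<theta>"
  by (simp add: projection_def h_sym[of _ y])

lemma projection_measurable [measurable]: "projection \<in> borel_measurable M"
  unfolding projection_altdef[abs_def] by measurable

lemma degenerate_part_measurable [measurable]:
  "(\<lambda>z. degenerate_part (fst z) (snd z)) \<in> borel_measurable (M \<Otimes>\<^sub>M M)"
  unfolding degenerate_part_def by measurable

lemma degenerate_part_sym: "degenerate_part x y = degenerate_part y x"
  by (simp add: degenerate_part_def h_sym[of x y])

lemma AE_projection_cube_le:
  "AE y in M. \<bar>projection y\<bar> ^ 3 \<le> (\<integral>y'. \<bar>h (y, y') - \<theta>\<bar> ^ 3 \<partial>M)"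
  using MM.AE_integrable_fst'[OF h_integrable] MM.AE_integrable_fst'[OF h_cube_integrable]
proof eventually_elim
  case (elim y)
  then have "projection y = expectation (\<lambda>y'. h (y, y') - \<theta>)"
    by (simp add: projection_altdef prob_space)
  with elim abs_expectation_cube_le[of "\<lambda>y'. h (y, y') - \<theta>"] show ?case by simp
qed

lemma projection_cube:
  shows "integrable M (\<lambda>y. \<bar>projection y\<bar> ^ 3)"
    and "(\<integral>y. \<bar>projection y\<bar> ^ 3 \<partial>M) \<le> third_moment"
proof -
  note i = MM.integrable_fst'[OF h_cube_integrable]
  show *: "integrable M (\<lambda>y. \<bar>projection y\<bar> ^ 3)"
    by (rule Bochner_Integration.integrable_bound[OF i])
       (use AE_projection_cube_le in \<open>auto elim!: eventually_mono\<close>)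
  have "(\<integral>y. \<bar>projection y\<bar> ^ 3 \<partial>M) \<le> (\<integral>y. (\<integral>y'. \<bar>h (y, y') - \<theta>\<bar> ^ 3 \<partial>M) \<partial>M)"
    by (rule integral_mono_AE[OF * i AE_projection_cube_le])
  then show "(\<integral>y. \<bar>projection y\<bar> ^ 3 \<partial>M) \<le> third_moment"
    by (simp add: MM.integral_fst'[OF h_cube_integrable] third_moment_def)
qed

lemmas projection_square = integrable_square_of_cube[OF projection_measurable projection_cube(1)]

lemma projection_integrable: "integrable M projection"
  using square_integrable_imp_integrable[OF projection_measurable projection_square(1)] .

lemma expectation_projection: "expectation projection = 0"
proof -
  have "expectation projection = (\<integral>y. (\<integral>y'. h (y, y') \<partial>M) \<partial>M) - \<theta>"
    unfolding projection_altdef[abs_def]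
    using MM.integrable_fst'[OF h_integrable] by (simp add: prob_space)
  also have "\<dots> = 0" by (simp add: MM.integral_fst'[OF h_integrable] kernel_mean_def)
  finally show ?thesis .
qed

lemma U_asymp_var_eq: "U_asymp_var M h = 4 * expectation (\<lambda>y. (projection y)\<^sup>2)"
proof -
  have "expectation (\<lambda>y'. \<integral>y. h (y, y') \<partial>M) = \<theta>"
    unfolding kernel_mean_def MM.integral_fst'[OF h_integrable, symmetric] by (subst h_sym) (rule refl)
  then show ?thesis by (simp add: U_asymp_var_def projection_def)
qed

text \<open>This holds for every \<open>y\<close>: where \<open>h (\<cdot>, y)\<close> fails to be integrable, so does the integrand, and
  its Bochner integral is \<open>0\<close> by convention.\<close>

lemma integral_degenerate_part_fst: "(\<integral>x. degenerate_part x y \<partial>M) = 0"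
proof (cases "integrable M (\<lambda>x. h (x, y))")
  case True
  then have "(\<integral>x. degenerate_part x y \<partial>M) = (\<integral>x. h (x, y) \<partial>M) - \<theta> - projection y"
    unfolding degenerate_part_def
    by (simp add: projection_integrable expectation_projection prob_space)
  then show ?thesis by (simp add: projection_def)
next
  case False
  have "\<not> integrable M (\<lambda>x. degenerate_part x y)"
  proof
    assume "integrable M (\<lambda>x. degenerate_part x y)"
    then have "integrable M (\<lambda>x. degenerate_part x y + (\<theta> + projection x + projection y))"
      using projection_integrable by (intro Bochner_Integration.integrable_add) auto
    with False show False by (simp add: degenerate_part_def)
  qed
  then show ?thesis by (rule not_integrable_integral_eq)
qed

lemma degenerate_part_square:
  shows "integrable (M \<Otimes>\<^sub>M M) (\<lambda>z. (degenerate_part (fst z) (snd z))\<^sup>2)"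
    and "(\<integral>z. (degenerate_part (fst z) (snd z))\<^sup>2 \<partial>(M \<Otimes>\<^sub>M M)) \<le> 9 * (1 + third_moment)"
proof -
  have h2: "integrable (M \<Otimes>\<^sub>M M) (\<lambda>z. (h z - \<theta>)\<^sup>2)"
    "(\<integral>z. (h z - \<theta>)\<^sup>2 \<partial>(M \<Otimes>\<^sub>M M)) \<le> 1 + third_moment"
    using MM.P.integrable_square_of_cube[OF _ h_cube_integrable] by (auto simp: third_moment_def)
  have d1: "distr (M \<Otimes>\<^sub>M M) M fst = M" by (rule distr_pair_fst)
  have "distr (M \<Otimes>\<^sub>M M) M fst = distr (M \<Otimes>\<^sub>M M) M snd"
    by (subst MM.distr_pair_swap) (simp add: distr_distr comp_def case_prod_unfold)
  with d1 have d2: "distr (M \<Otimes>\<^sub>M M) M snd = M" by simp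
  have g1: "integrable (M \<Otimes>\<^sub>M M) (\<lambda>z. (projection (fst z))\<^sup>2)"
    "(\<integral>z. (projection (fst z))\<^sup>2 \<partial>(M \<Otimes>\<^sub>M M)) \<le> 1 + third_moment"
    using projection_square projection_cube(2)
      integrable_distr_eq[of fst "M \<Otimes>\<^sub>M M" M "\<lambda>y. (projection y)\<^sup>2"]
      integral_distr[of fst "M \<Otimes>\<^sub>M M" M "\<lambda>y. (projection y)\<^sup>2"]
    unfolding d1 by auto
  have g2: "integrable (M \<Otimes>\<^sub>M M) (\<lambda>z. (projection (snd z))\<^sup>2)"
    "(\<integral>z. (projection (snd z))\<^sup>2 \<partial>(M \<Otimes>\<^sub>M M)) \<le> 1 + third_moment"
    using projection_square projection_cube(2)
      integrable_distr_eq[of snd "M \<Otimes>\<^sub>M M" M "\<lambda>y. (projection y)\<^sup>2"]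
      integral_distr[of snd "M \<Otimes>\<^sub>M M" M "\<lambda>y. (projection y)\<^sup>2"]
    unfolding d2 by auto
  let ?B = "\<lambda>z. 3 * ((h z - \<theta>)\<^sup>2 + (projection (fst z))\<^sup>2 + (projection (snd z))\<^sup>2)"
  have "(a - b - c)\<^sup>2 \<le> 3 * (a\<^sup>2 + b\<^sup>2 + c\<^sup>2)" for a b c :: real
  proof -
    have "0 \<le> (a + b)\<^sup>2 + (a + c)\<^sup>2 + (b - c)\<^sup>2" by simp
    then show ?thesis by (simp add: power2_eq_square algebra_simps)
  qed
  then have le: "(degenerate_part (fst z) (snd z))\<^sup>2 \<le> ?B z" for z
    by (simp add: degenerate_part_def)
  have i: "integrable (M \<Otimes>\<^sub>M M) ?B" using h2 g1 g2 by simp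
  show *: "integrable (M \<Otimes>\<^sub>M M) (\<lambda>z. (degenerate_part (fst z) (snd z))\<^sup>2)"
    by (rule Bochner_Integration.integrable_bound[OF i]) (use le in \<open>auto intro!: AE_I2\<close>)
  have "(\<integral>z. (degenerate_part (fst z) (snd z))\<^sup>2 \<partial>(M \<Otimes>\<^sub>M M)) \<le> (\<integral>z. ?B z \<partial>(M \<Otimes>\<^sub>M M))"
    by (rule integral_mono[OF * i le])
  also have "\<dots> \<le> 9 * (1 + third_moment)" using h2 g1 g2 by simp
  finally show "(\<integral>z. (degenerate_part (fst z) (snd z))\<^sup>2 \<partial>(M \<Otimes>\<^sub>M M)) \<le> 9 * (1 + third_moment)" .
qed

lemma hoeffding_decomposition:
  assumes "n \<ge> 2"
  shows "U_stat h n x - \<theta> = 2 / real n * (\<Sum>i\<in>{1..n}. projection (x i))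
    + 1 / (real n * (real n - 1)) * (\<Sum>(i, j)\<in>off_diagonal n. degenerate_part (x i) (x j))"
proof -
  let ?N = "real n * (real n - 1)"
  have "(\<Sum>(i, j)\<in>off_diagonal n. h (x i, x j))
      = (\<Sum>(i, j)\<in>off_diagonal n. degenerate_part (x i) (x j))
        + (\<Sum>(i, j)\<in>off_diagonal n. projection (x i) + projection (x j))
        + (\<Sum>(i, j)\<in>off_diagonal n. \<theta>)"
    unfolding sum.distrib[symmetric] by (intro sum.cong) (auto simp: degenerate_part_def)
  also have "\<dots> = (\<Sum>(i, j)\<in>off_diagonal n. degenerate_part (x i) (x j))
        + 2 * (real n - 1) * (\<Sum>i\<in>{1..n}. projection (x i)) + ?N * \<theta>"
    using sum_off_diagonal_add[of "\<lambda>i. projection (x i)" n]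
    by (simp add: case_prod_unfold card_off_diagonal)
  finally have sum_eq: "(\<Sum>(i, j)\<in>off_diagonal n. h (x i, x j)) = \<dots>" .
  have *: "1 / (a * b) * (p + 2 * b * q + a * b * c) - c = 2 / a * q + 1 / (a * b) * p"
    if "a \<noteq> 0" "b \<noteq> 0" for a b c p q :: real
    using that by (simp add: field_simps)
  show ?thesis
    unfolding U_stat_def off_diagonal_def[symmetric] sum_eq using assms by (intro *) auto
qed


abbreviation sample :: "nat \<Rightarrow> (nat \<Rightarrow> 'a) measure" where
  "sample n \<equiv> \<Pi>\<^sub>M i\<in>{1..n}. M"

lemma prob_space_sample: "prob_space (sample n)"
  by (intro prob_space_PiM prob_space_axioms)

lemma projection_coordinate_square:
  assumes "i \<in> {1..n}"
  shows "integrable (sample n) (\<lambda>x. (projection (x i))\<^sup>2)"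
    and "(\<integral>x. (projection (x i))\<^sup>2 \<partial>sample n) = expectation (\<lambda>y. (projection y)\<^sup>2)"
  using projection_square(1) assms
    integrable_distr_eq[of "\<lambda>x. x i" "sample n" M "\<lambda>y. (projection y)\<^sup>2"]
    integral_distr[of "\<lambda>x. x i" "sample n" M "\<lambda>y. (projection y)\<^sup>2"]
  by (auto simp: distr_PiM_coordinate)

lemma degenerate_part_coordinates_measurable [measurable]:
  assumes "i \<in> {1..n}" "j \<in> {1..n}"
  shows "(\<lambda>x. degenerate_part (x i) (x j)) \<in> borel_measurable (sample n)"
proof -
  have "(\<lambda>x. (x i, x j)) \<in> sample n \<rightarrow>\<^sub>M M \<Otimes>\<^sub>M M" using assms by measurable
  from measurable_compose[OF this degenerate_part_measurable] show ?thesis by simp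
qed

lemma degenerate_part_coordinates_square:
  assumes "i \<in> {1..n}" "j \<in> {1..n}" "i \<noteq> j"
  shows "integrable (sample n) (\<lambda>x. (degenerate_part (x i) (x j))\<^sup>2)"
    and "(\<integral>x. (degenerate_part (x i) (x j))\<^sup>2 \<partial>sample n) \<le> 9 * (1 + third_moment)"
  using degenerate_part_square assms
    integrable_distr_eq[of "\<lambda>x. (x i, x j)" "sample n" "M \<Otimes>\<^sub>M M"
      "\<lambda>z. (degenerate_part (fst z) (snd z))\<^sup>2"]
    integral_distr[of "\<lambda>x. (x i, x j)" "sample n" "M \<Otimes>\<^sub>M M"
      "\<lambda>z. (degenerate_part (fst z) (snd z))\<^sup>2"]
  by (auto simp: distr_PiM_coordinate_pair)

lemma sum_projection_square:
  shows "integrable (sample n) (\<lambda>x. (\<Sum>i\<in>{1..n}. projection (x i))\<^sup>2)"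
    and "(\<integral>x. (\<Sum>i\<in>{1..n}. projection (x i))\<^sup>2 \<partial>sample n) = n * expectation (\<lambda>y. (projection y)\<^sup>2)"
proof -
  have m: "(\<lambda>x. projection (x i)) \<in> borel_measurable (sample n)" if "i \<in> {1..n}" for i
    using that by measurable
  note sq = expectation_square_sum[OF m projection_coordinate_square(1)]
  show "integrable (sample n) (\<lambda>x. (\<Sum>i\<in>{1..n}. projection (x i))\<^sup>2)" by (rule sq(1))
  have orth: "(\<integral>x. projection (x i) * projection (x j) \<partial>sample n)
      = (if i = j then expectation (\<lambda>y. (projection y)\<^sup>2) else 0)"
    if "i \<in> {1..n}" "j \<in> {1..n}" for i j
  proof (cases "i = j")
    case True
    then show ?thesis using projection_coordinate_square(2)[OF that(1)] by (simp add: power2_eq_square)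
  next
    case False
    have "(\<integral>x. projection (x i) * projection (x j) \<partial>sample n) = 0"
      using False that
      by (intro integral_PiM_eq_0[of _ i] integrable_mult_of_squares m projection_coordinate_square(1))
         (auto simp: expectation_projection)
    with False show ?thesis by simp
  qed
  show "(\<integral>x. (\<Sum>i\<in>{1..n}. projection (x i))\<^sup>2 \<partial>sample n) = n * expectation (\<lambda>y. (projection y)\<^sup>2)"
  proof -
    have "(\<integral>x. (\<Sum>i\<in>{1..n}. projection (x i))\<^sup>2 \<partial>sample n)
        = (\<Sum>i\<in>{1..n}. \<Sum>j\<in>{1..n}. \<integral>x. projection (x i) * projection (x j) \<partial>sample n)"
      by (rule sq(2))
    also have "\<dots> = (\<Sum>i\<in>{1..n}. \<Sum>j\<in>{1..n}. if i = j then expectation (\<lambda>y. (projection y)\<^sup>2) else 0)"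
      by (intro sum.cong refl orth)
    finally show ?thesis by simp
  qed
qed

lemma degenerate_part_orthogonal:
  assumes "p \<in> off_diagonal n" "q \<in> off_diagonal n" "q \<noteq> p" "q \<noteq> prod.swap p"
  shows "(\<integral>x. degenerate_part (x (fst p)) (x (snd p)) * degenerate_part (x (fst q)) (x (snd q)) \<partial>sample n) = 0"
proof -
  obtain i j k l where pq: "p = (i, j)" "q = (k, l)" by (cases p, cases q)
  with assms have m: "i \<in> {1..n}" "j \<in> {1..n}" "i \<noteq> j" "k \<in> {1..n}" "l \<in> {1..n}" "k \<noteq> l"
    by (auto simp: off_diagonal_def)
  have int: "integrable (sample n) (\<lambda>x. degenerate_part (x i) (x j) * degenerate_part (x k) (x l))"
    using m by (intro integrable_mult_of_squares degenerate_part_coordinates_square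
      degenerate_part_coordinates_measurable)
  have snd0: "(\<integral>y. degenerate_part a y \<partial>M) = 0" for a
    unfolding degenerate_part_sym[of a] by (rule integral_degenerate_part_fst)
  consider "i \<notin> {k, l}" | "j \<notin> {k, l}"
    using assms(3,4) m(3) pq by auto
  then have "(\<integral>x. degenerate_part (x i) (x j) * degenerate_part (x k) (x l) \<partial>sample n) = 0"
  proof cases
    case 1
    with m show ?thesis by (intro integral_PiM_eq_0[OF _ m(1) int]) (auto simp: integral_degenerate_part_fst)
  next
    case 2
    with m show ?thesis by (intro integral_PiM_eq_0[OF _ m(2) int]) (auto simp: snd0)
  qed
  with pq show ?thesis by simp
qed

lemma sum_degenerate_part_square:
  shows "integrable (sample n) (\<lambda>x. (\<Sum>(i, j)\<in>off_diagonal n. degenerate_part (x i) (x j))\<^sup>2)"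
    and "(\<integral>x. (\<Sum>(i, j)\<in>off_diagonal n. degenerate_part (x i) (x j))\<^sup>2 \<partial>sample n)
      \<le> 18 * (1 + third_moment) * (real n * (real n - 1))"
proof -
  let ?F = "\<lambda>p x. degenerate_part (x (fst p)) (x (snd p))"
  have m: "?F p \<in> borel_measurable (sample n)"
    and s: "integrable (sample n) (\<lambda>x. (?F p x)\<^sup>2)"
    and le: "(\<integral>x. (?F p x)\<^sup>2 \<partial>sample n) \<le> 9 * (1 + third_moment)" if "p \<in> off_diagonal n" for p
    using that degenerate_part_coordinates_square[of "fst p" n "snd p"]
      degenerate_part_coordinates_measurable[of "fst p" n "snd p"]
    by (auto simp: off_diagonal_def)
  note sq = expectation_square_sum[OF m s]
  show "integrable (sample n) (\<lambda>x. (\<Sum>(i, j)\<in>off_diagonal n. degenerate_part (x i) (x j))\<^sup>2)"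
    using sq(1) by (simp add: case_prod_unfold)
  have "(\<Sum>q\<in>off_diagonal n. \<integral>x. ?F p x * ?F q x \<partial>sample n) \<le> 18 * (1 + third_moment)"
    if p: "p \<in> off_diagonal n" for p
  proof -
    have sw: "?F (prod.swap p) = ?F p" by (simp add: fun_eq_iff degenerate_part_sym)
    have "(\<Sum>q\<in>off_diagonal n. \<integral>x. ?F p x * ?F q x \<partial>sample n)
        = (\<Sum>q\<in>{p, prod.swap p}. \<integral>x. ?F p x * ?F q x \<partial>sample n)"
      using p degenerate_part_orthogonal[OF p]
      by (intro sum.mono_neutral_right finite_off_diagonal) (auto simp: off_diagonal_def)
    also have "\<dots> = 2 * (\<integral>x. (?F p x)\<^sup>2 \<partial>sample n)"
      using p by (cases p) (auto simp: off_diagonal_def power2_eq_square degenerate_part_sym)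
    finally show ?thesis using le[OF p] by simp
  qed
  then have "(\<Sum>p\<in>off_diagonal n. \<Sum>q\<in>off_diagonal n. \<integral>x. ?F p x * ?F q x \<partial>sample n)
      \<le> (\<Sum>p\<in>off_diagonal n. 18 * (1 + third_moment))"
    by (rule sum_mono)
  also have "\<dots> = 18 * (1 + third_moment) * (real n * (real n - 1))"
    by (simp add: card_off_diagonal)
  finally show "(\<integral>x. (\<Sum>(i, j)\<in>off_diagonal n. degenerate_part (x i) (x j))\<^sup>2 \<partial>sample n)
      \<le> 18 * (1 + third_moment) * (real n * (real n - 1))"
    unfolding case_prod_unfold by (subst sq(2))
qed


lemma sum_degenerate_part_measurable [measurable]:
  "(\<lambda>x. \<Sum>(i, j)\<in>off_diagonal n. degenerate_part (x i) (x j)) \<in> borel_measurable (sample n)"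
  unfolding case_prod_unfold
  by (intro borel_measurable_sum degenerate_part_coordinates_measurable) (auto simp: off_diagonal_def)

lemma char_linear_part_le:
  assumes "n \<ge> 1" "0 \<le> s" "t\<^sup>2 * s / (2 * real n) \<le> 2"
  shows "cmod (char (distr (sample n) borel (\<lambda>x. 2 / sqrt n * (\<Sum>i\<in>{1..n}. projection (x i)))) t
      - complex_of_real ((1 - t\<^sup>2 * s / (2 * real n)) ^ n))
    \<le> t\<^sup>2 * \<bar>U_asymp_var M h - s\<bar> / 2 + 4 / 3 * \<bar>t\<bar> ^ 3 * third_moment / sqrt n"
proof -
  interpret P: prob_space "sample n" by (rule prob_space_sample)
  define X where "X y = 2 / sqrt n * projection y" for y
  define v where "v = U_asymp_var M h"
  define \<phi> where "\<phi> = char (distr M borel X) t"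
  have n: "real n > 0" using assms(1) by simp
  have [measurable]: "X \<in> borel_measurable M" unfolding X_def by measurable
  have X: "integrable M X" "expectation X = 0"
    unfolding X_def by (auto simp: projection_integrable expectation_projection)
  have X2: "(X y)\<^sup>2 = 4 / n * (projection y)\<^sup>2" for y
    using n by (simp add: X_def power_mult_distrib power_divide)
  have X2i: "integrable M (\<lambda>y. (X y)\<^sup>2)" unfolding X2 using projection_square by simp
  have var: "variance X = v / n"
    unfolding X(2) by (simp add: X2 v_def U_asymp_var_eq)
  have X3: "\<bar>X y\<bar> ^ 3 = 8 / (n * sqrt n) * \<bar>projection y\<bar> ^ 3" for y
    using n by (simp add: X_def abs_mult power_mult_distrib power_divide power3_eq_cube)
  have X3i: "integrable M (\<lambda>y. \<bar>X y\<bar> ^ 3)" unfolding X3 using projection_cube by simp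
  have t3: "\<bar>t\<bar> ^ 3 = t\<^sup>2 * \<bar>t\<bar>" by (simp add: power3_eq_cube power2_eq_square)
  interpret D: real_distribution "distr M borel X" by (rule real_distribution_distr) simp
  have "(\<lambda>x. 2 / sqrt n * (\<Sum>i\<in>{1..n}. projection (x i))) = (\<lambda>x. \<Sum>i\<in>{1..n}. X (x i))"
    by (simp add: X_def sum_distrib_left)
  moreover have "P.indep_vars (\<lambda>_. borel) (\<lambda>i x. X (x i)) {1..n}"
    using assms(1) by (intro P.indep_vars_compose2[OF indep_vars_PiM_coordinates]) auto
  moreover have "distr (sample n) borel (\<lambda>x. X (x i)) = distr M borel X" if "i \<in> {1..n}" for i
  proof -
    have "distr (sample n) borel (\<lambda>x. X (x i)) = distr (distr (sample n) M (\<lambda>x. x i)) borel X"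
      using that by (subst distr_distr) (auto simp: comp_def)
    then show ?thesis using that by (simp add: distr_PiM_coordinate)
  qed
  ultimately have char_eq:
    "char (distr (sample n) borel (\<lambda>x. 2 / sqrt n * (\<Sum>i\<in>{1..n}. projection (x i)))) t = \<phi> ^ n"
    by (simp add: P.char_distr_sum \<phi>_def del: One_nat_def)
  have "cmod (\<phi> - (1 - t\<^sup>2 * (v / n) / 2)) \<le> t\<^sup>2 / 6 * expectation (\<lambda>y. min (6 * (X y)\<^sup>2) (\<bar>t\<bar> * \<bar>X y\<bar> ^ 3))"
    using char_approx3'[OF _ X(1) X2i X(2) var refl, of t] by (simp add: \<phi>_def)
  also have "\<dots> \<le> t\<^sup>2 / 6 * expectation (\<lambda>y. \<bar>t\<bar> * \<bar>X y\<bar> ^ 3)"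
    using X2i X3i by (intro mult_left_mono integral_mono integrable_min) auto
  also have "\<dots> = 4 / 3 * \<bar>t\<bar> ^ 3 * expectation (\<lambda>y. \<bar>projection y\<bar> ^ 3) / (n * sqrt n)"
    unfolding X3 t3 by simp
  also have "\<dots> \<le> 4 / 3 * \<bar>t\<bar> ^ 3 * third_moment / (n * sqrt n)"
    using n projection_cube(2) by (intro divide_right_mono mult_left_mono) auto
  finally have "cmod (\<phi> - (1 - t\<^sup>2 * (v / n) / 2)) \<le> 4 / 3 * \<bar>t\<bar> ^ 3 * third_moment / (n * sqrt n)" .
  moreover have "cmod ((1 - t\<^sup>2 * (v / n) / 2) - complex_of_real (1 - t\<^sup>2 * s / (2 * n))) = t\<^sup>2 * \<bar>v - s\<bar> / (2 * n)"
  proof -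
    have "(1 - t\<^sup>2 * (v / n) / 2) - complex_of_real (1 - t\<^sup>2 * s / (2 * n)) = complex_of_real (t\<^sup>2 * (s - v) / (2 * n))"
      using n by (simp add: field_simps)
    then show ?thesis by (simp only: norm_of_real) (simp add: abs_mult abs_minus_commute)
  qed
  ultimately have "cmod (\<phi> - complex_of_real (1 - t\<^sup>2 * s / (2 * n)))
      \<le> 4 / 3 * \<bar>t\<bar> ^ 3 * third_moment / (n * sqrt n) + t\<^sup>2 * \<bar>v - s\<bar> / (2 * n)"
    by (rule norm_diff_triangle_le[OF _ eq_refl])
  then have "n * cmod (\<phi> - complex_of_real (1 - t\<^sup>2 * s / (2 * n)))
      \<le> n * (4 / 3 * \<bar>t\<bar> ^ 3 * third_moment / (n * sqrt n) + t\<^sup>2 * \<bar>v - s\<bar> / (2 * n))"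
    by (intro mult_left_mono) auto
  also have "\<dots> = t\<^sup>2 * \<bar>v - s\<bar> / 2 + 4 / 3 * \<bar>t\<bar> ^ 3 * third_moment / sqrt n"
    using n by (simp add: field_simps)
  finally have "n * cmod (\<phi> - complex_of_real (1 - t\<^sup>2 * s / (2 * n))) \<le> \<dots>" .
  moreover have "cmod (\<phi> ^ n - complex_of_real (1 - t\<^sup>2 * s / (2 * n)) ^ n)
      \<le> n * cmod (\<phi> - complex_of_real (1 - t\<^sup>2 * s / (2 * n)))"
  proof (rule norm_power_diff)
    show "cmod \<phi> \<le> 1" unfolding \<phi>_def by (rule D.cmod_char_le_1)
    have "0 \<le> t\<^sup>2 * s / (2 * n)" using assms(2) by simp
    then show "cmod (complex_of_real (1 - t\<^sup>2 * s / (2 * n))) \<le> 1"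
      unfolding norm_of_real using assms(3) by linarith
  qed
  ultimately show ?thesis unfolding char_eq v_def by simp
qed

definition quadratic_part :: "nat \<Rightarrow> (nat \<Rightarrow> 'a) \<Rightarrow> real" where
  "quadratic_part n x = sqrt n / (real n * (real n - 1))
     * (\<Sum>(i, j)\<in>off_diagonal n. degenerate_part (x i) (x j))"

lemma quadratic_part_measurable [measurable]: "quadratic_part n \<in> borel_measurable (sample n)"
  unfolding quadratic_part_def by measurable

lemma quadratic_part_square:
  assumes "n \<ge> 2"
  shows "integrable (sample n) (\<lambda>x. (quadratic_part n x)\<^sup>2)"
    and "(\<integral>x. (quadratic_part n x)\<^sup>2 \<partial>sample n) \<le> 18 * (1 + third_moment) / (real n - 1)"
proof -
  let ?S = "\<lambda>x. \<Sum>(i, j)\<in>off_diagonal n. degenerate_part (x i) (x j)"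
  have n: "real n > 0" "real n - 1 > 0" using assms by auto
  have eq: "(quadratic_part n x)\<^sup>2 = real n / (real n * (real n - 1))\<^sup>2 * (?S x)\<^sup>2" for x
    by (simp add: quadratic_part_def power_mult_distrib power_divide)
  show "integrable (sample n) (\<lambda>x. (quadratic_part n x)\<^sup>2)"
    unfolding eq using sum_degenerate_part_square(1) by simp
  have "(\<integral>x. (quadratic_part n x)\<^sup>2 \<partial>sample n)
      = real n / (real n * (real n - 1))\<^sup>2 * (\<integral>x. (?S x)\<^sup>2 \<partial>sample n)"
    unfolding eq by (rule integral_mult_right_zero)
  also have "\<dots> \<le> real n / (real n * (real n - 1))\<^sup>2 * (18 * (1 + third_moment) * (real n * (real n - 1)))"
    by (intro mult_left_mono sum_degenerate_part_square) auto
  also have "\<dots> = 18 * (1 + third_moment) / (real n - 1)"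
  proof -
    have "a / (a * b)\<^sup>2 * (k * (a * b)) = k / b" if "a \<noteq> 0" "b \<noteq> 0" for a b k :: real
      using that by (simp add: power2_eq_square)
    then show ?thesis using n by (metis less_irrefl)
  qed
  finally show "(\<integral>x. (quadratic_part n x)\<^sup>2 \<partial>sample n) \<le> 18 * (1 + third_moment) / (real n - 1)" .
qed

lemma scaled_U_stat_eq:
  assumes "n \<ge> 2"
  shows "sqrt n * (U_stat h n x - c) = 2 / sqrt n * (\<Sum>i\<in>{1..n}. projection (x i))
    + (quadratic_part n x + sqrt n * (\<theta> - c))"
proof -
  have "sqrt n * (U_stat h n x - c) = sqrt n * (U_stat h n x - \<theta>) + sqrt n * (\<theta> - c)"
    by (simp add: algebra_simps)
  also have "sqrt n * (U_stat h n x - \<theta>) = sqrt n * (2 / n) * (\<Sum>i\<in>{1..n}. projection (x i)) + quadratic_part n x"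
    unfolding hoeffding_decomposition[OF assms] quadratic_part_def by (simp add: algebra_simps)
  also have "sqrt n * (2 / n) = 2 / sqrt n"
    using assms by (simp add: field_simps)
  finally show ?thesis by simp
qed

lemma U_stat_measurable [measurable]:
  assumes "n \<ge> 2"
  shows "(\<lambda>x. sqrt n * (U_stat h n x - c)) \<in> borel_measurable (sample n)"
  unfolding scaled_U_stat_eq[OF assms] by measurable

lemma char_U_stat_le:
  assumes "n \<ge> 2" "0 \<le> s" "t\<^sup>2 * s / (2 * real n) \<le> 2"
  shows "cmod (char (distr (sample n) borel (\<lambda>x. sqrt n * (U_stat h n x - c))) t
      - complex_of_real ((1 - t\<^sup>2 * s / (2 * real n)) ^ n))
    \<le> \<bar>t\<bar> * (sqrt (18 * (1 + third_moment) / (real n - 1)) + \<bar>sqrt n * (\<theta> - c)\<bar>)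
      + (t\<^sup>2 * \<bar>U_asymp_var M h - s\<bar> / 2 + 4 / 3 * \<bar>t\<bar> ^ 3 * third_moment / sqrt n)"
proof -
  interpret P: prob_space "sample n" by (rule prob_space_sample)
  let ?Z = "\<lambda>x. quadratic_part n x + sqrt n * (\<theta> - c)"
  have q: "integrable (sample n) (quadratic_part n)"
    by (rule P.square_integrable_imp_integrable[OF _ quadratic_part_square(1)[OF assms(1)]])
       (rule quadratic_part_measurable)
  have "P.expectation (\<lambda>x. \<bar>?Z x\<bar>) \<le> P.expectation (\<lambda>x. \<bar>quadratic_part n x\<bar> + \<bar>sqrt n * (\<theta> - c)\<bar>)"
    using q by (intro integral_mono abs_triangle_ineq) (auto simp del: One_nat_def)
  also have "\<dots> = P.expectation (\<lambda>x. \<bar>quadratic_part n x\<bar>) + \<bar>sqrt n * (\<theta> - c)\<bar>"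
    using q by (simp add: P.prob_space del: One_nat_def)
  also have "P.expectation (\<lambda>x. \<bar>quadratic_part n x\<bar>) \<le> sqrt (P.expectation (\<lambda>x. (quadratic_part n x)\<^sup>2))"
    by (intro P.abs_expectation_le_sqrt quadratic_part_square quadratic_part_measurable assms)
  also have "\<dots> \<le> sqrt (18 * (1 + third_moment) / (real n - 1))"
    by (intro real_sqrt_le_mono quadratic_part_square assms)
  finally have "\<bar>t\<bar> * P.expectation (\<lambda>x. \<bar>?Z x\<bar>)
      \<le> \<bar>t\<bar> * (sqrt (18 * (1 + third_moment) / (real n - 1)) + \<bar>sqrt n * (\<theta> - c)\<bar>)"
    by (intro mult_left_mono) auto
  moreover have "cmod (char (distr (sample n) borel (\<lambda>x. sqrt n * (U_stat h n x - c))) t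
      - char (distr (sample n) borel (\<lambda>x. 2 / sqrt n * (\<Sum>i\<in>{1..n}. projection (x i)))) t)
      \<le> \<bar>t\<bar> * P.expectation (\<lambda>x. \<bar>?Z x\<bar>)"
    unfolding scaled_U_stat_eq[OF assms(1)] using q
    by (intro P.char_distr_add_diff_le) (auto simp del: One_nat_def)
  ultimately show ?thesis
    using assms by (intro norm_diff_triangle_le[OF _ char_linear_part_le]) auto
qed

lemma prob_U_stat_le:
  assumes "n \<ge> 2" "\<epsilon> > 0"
  shows "measure (sample n) {x \<in> space (sample n). \<bar>sqrt n * (U_stat h n x - c)\<bar> \<ge> \<epsilon>}
    \<le> 3 * (U_asymp_var M h + 18 * (1 + third_moment) / (real n - 1) + (sqrt n * (\<theta> - c))\<^sup>2) / \<epsilon>\<^sup>2"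
proof -
  interpret P: prob_space "sample n" by (rule prob_space_sample)
  let ?W = "\<lambda>x. sqrt n * (U_stat h n x - c)"
  let ?B = "\<lambda>x. 3 * (4 / n * (\<Sum>i\<in>{1..n}. projection (x i))\<^sup>2 + (quadratic_part n x)\<^sup>2 + (sqrt n * (\<theta> - c))\<^sup>2)"
  have n: "real n > 0" using assms by simp
  note q = quadratic_part_square[OF assms(1)]
  have sq3: "(a + (b + d))\<^sup>2 \<le> 3 * (a\<^sup>2 + b\<^sup>2 + d\<^sup>2)" for a b d :: real
  proof -
    have "0 \<le> (a - b)\<^sup>2 + (a - d)\<^sup>2 + (b - d)\<^sup>2" by simp
    then show ?thesis by (simp add: power2_eq_square algebra_simps)
  qed
  have le: "(?W x)\<^sup>2 \<le> ?B x" for x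
    using sq3[of "2 / sqrt n * (\<Sum>i\<in>{1..n}. projection (x i))" "quadratic_part n x" "sqrt n * (\<theta> - c)"] n
    unfolding scaled_U_stat_eq[OF assms(1)]
    by (simp add: power_mult_distrib[of "2 / sqrt n"] power_divide)
  have i: "integrable (sample n) ?B" using q(1) sum_projection_square(1)[of n] by (simp del: One_nat_def)
  have Wm: "?W \<in> borel_measurable (sample n)" using assms(1) by measurable
  have i2: "integrable (sample n) (\<lambda>x. (?W x)\<^sup>2)"
    by (rule Bochner_Integration.integrable_bound[OF i]) (use le Wm in \<open>auto intro!: AE_I2\<close>)
  have "P.expectation (\<lambda>x. (?W x)\<^sup>2) \<le> P.expectation ?B" by (rule integral_mono[OF i2 i le])
  also have "\<dots> = 3 * (U_asymp_var M h + P.expectation (\<lambda>x. (quadratic_part n x)\<^sup>2) + (sqrt n * (\<theta> - c))\<^sup>2)"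
    using q(1) sum_projection_square[of n] n by (simp add: P.prob_space U_asymp_var_eq del: One_nat_def)
  also have "\<dots> \<le> 3 * (U_asymp_var M h + 18 * (1 + third_moment) / (real n - 1) + (sqrt n * (\<theta> - c))\<^sup>2)"
    by (intro mult_left_mono add_mono q(2)) auto
  finally have *: "P.expectation (\<lambda>x. (?W x)\<^sup>2) \<le> \<dots>" .
  show ?thesis
    using P.second_moment_method[OF Wm i2 assms(2)] divide_right_mono[OF *, of "\<epsilon>\<^sup>2"] by simp
qed

end

subsection \<open>The triangular array\<close>

theorem theorem1:
  fixes \<gamma>s :: "nat \<Rightarrow> 'y::polish_space measure"
    and \<gamma> :: "'y measure"
    and h :: "'y \<times> 'y \<Rightarrow> real"
    and \<Omega> :: "nat \<Rightarrow> nat \<Rightarrow> 'w measure"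
    and Y :: "nat \<Rightarrow> nat \<Rightarrow> nat \<Rightarrow> 'w \<Rightarrow> 'y"
    and \<sigma> :: real
    and t :: "nat \<Rightarrow> nat"
  assumes "\<And>s. s \<ge> 1 \<Longrightarrow> prob_space (\<gamma>s s)"
    and "\<And>s. s \<ge> 1 \<Longrightarrow> sets (\<gamma>s s) = sets borel"
    and "prob_space \<gamma>"
    and "sets \<gamma> = sets borel"
    and "h \<in> borel_measurable (borel \<Otimes>\<^sub>M borel)"
    and "\<And>y y'. h (y, y') = h (y', y)"
    and "\<And>s. s \<ge> 1 \<Longrightarrow> integrable (\<gamma>s s \<Otimes>\<^sub>M \<gamma>s s) h"
    and "integrable (\<gamma> \<Otimes>\<^sub>M \<gamma>) h"
    and "\<And>s n. s \<ge> 1 \<Longrightarrow> n \<ge> 2 \<Longrightarrow> prob_space (\<Omega> s n)"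
    and "\<And>s n. s \<ge> 1 \<Longrightarrow> n \<ge> 2 \<Longrightarrow>
           prob_space.indep_vars (\<Omega> s n) (\<lambda>i. borel) (Y s n) {1..n}"
    and "\<And>s n i. s \<ge> 1 \<Longrightarrow> n \<ge> 2 \<Longrightarrow> i \<in> {1..n} \<Longrightarrow>
           distr (\<Omega> s n) borel (Y s n i) = \<gamma>s s"
    and "limsup (\<lambda>s. kernel_L3_dev (\<gamma>s s) h) < \<infinity>"
    and "\<sigma> \<ge> 0"
    and "(\<lambda>s. U_asymp_var (\<gamma>s s) h) \<longlonglongrightarrow> \<sigma>\<^sup>2"
    and "(\<lambda>s. kernel_mean (\<gamma>s s) h) \<longlonglongrightarrow> kernel_mean \<gamma> h"
    and "filterlim t at_top sequentially"
    and "(\<lambda>n. sqrt (real n) * (kernel_mean (\<gamma>s (t n)) h - kernel_mean \<gamma> h)) \<longlonglongrightarrow> 0"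
  shows "(\<sigma> > 0 \<longrightarrow>
           weak_conv_m
             (\<lambda>n. distr (\<Omega> (t n) n) borel
                (\<lambda>\<omega>. sqrt (real n) * (U_stat h n (\<lambda>i. Y (t n) n i \<omega>) - kernel_mean \<gamma> h)))
             (density lborel (normal_density 0 \<sigma>)))
       \<and> (\<sigma> = 0 \<longrightarrow>
           converges_in_prob
             (\<lambda>n. \<Omega> (t n) n)
             (\<lambda>n \<omega>. sqrt (real n) * (U_stat h n (\<lambda>i. Y (t n) n i \<omega>) - kernel_mean \<gamma> h))
             0)"
proof -
  note assms_measures = assms(1,2) and assms_sample = assms(9-11)
  let ?c = "kernel_mean \<gamma> h"
  let ?W = "\<lambda>n \<omega>. sqrt (real n) * (U_stat h n (\<lambda>i. Y (t n) n i \<omega>) - ?c)"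
  let ?V = "\<lambda>n x. sqrt (real n) * (U_stat h n x - ?c)"
  let ?P = "\<lambda>n. \<Pi>\<^sub>M i\<in>{1..n}. \<gamma>s (t n)"
  define d where "d n = sqrt (real n) * (kernel_mean (\<gamma>s (t n)) h - ?c)" for n
  define v where "v n = U_asymp_var (\<gamma>s (t n)) h" for n
  have d: "d \<longlonglongrightarrow> 0" using assms(17) by (simp add: d_def[abs_def])
  have v: "v \<longlonglongrightarrow> \<sigma>\<^sup>2"
    unfolding v_def by (rule filterlim_compose[OF assms(14) assms(16)])

  obtain C' where C': "limsup (\<lambda>s. kernel_L3_dev (\<gamma>s s) h) < C'" "C' < \<infinity>"
    using dense[OF assms(12)] by auto
  then obtain B where B: "C' = ennreal B" "0 \<le> B" by (cases C') auto
  have "\<forall>\<^sub>F s in sequentially. kernel_L3_dev (\<gamma>s s) h < ennreal B"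
    using C'(1) unfolding B by (rule Limsup_lessD)
  then have "\<forall>\<^sub>F s in sequentially. kernel_L3_dev (\<gamma>s s) h < ennreal B \<and> s \<ge> 1"
    by (intro eventually_conj eventually_ge_at_top)
  then have "\<forall>\<^sub>F n in sequentially. kernel_L3_dev (\<gamma>s (t n)) h < ennreal B \<and> t n \<ge> 1"
    by (rule eventually_compose_filterlim[OF _ assms(16)])
  then have ev: "\<forall>\<^sub>F n in sequentially. kernel_L3_dev (\<gamma>s (t n)) h < ennreal B \<and> t n \<ge> 1 \<and> n \<ge> 2"
    using eventually_ge_at_top[of 2] by eventually_elim auto
  define good where "good n \<longleftrightarrow> symmetric_kernel (\<gamma>s (t n)) h
      \<and> symmetric_kernel.third_moment (\<gamma>s (t n)) h \<le> B ^ 3 \<and> n \<ge> 2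
      \<and> ?W n \<in> borel_measurable (\<Omega> (t n) n) \<and> prob_space (\<Omega> (t n) n)
      \<and> distr (\<Omega> (t n) n) borel (?W n) = distr (?P n) borel (?V n)" for n
  have good: "\<forall>\<^sub>F n in sequentially. good n"
    using ev
  proof eventually_elim
    case (elim n)
    then have n: "t n \<ge> 1" "n \<ge> 2" and L3: "kernel_L3_dev (\<gamma>s (t n)) h < ennreal B" by auto
    interpret prob_space "\<gamma>s (t n)" using assms_measures n by auto
    have hm: "h \<in> borel_measurable (\<gamma>s (t n) \<Otimes>\<^sub>M \<gamma>s (t n))"
      using assms(5) measurable_cong_sets[OF sets_pair_measure_cong[OF assms(2) assms(2)] refl] n by blast
    interpret symmetric_kernel "\<gamma>s (t n)" h
      by unfold_locales (use hm assms(6,7) n kernel_L3_dev_bound(1)[OF hm L3] in auto)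
    interpret \<Omega>: prob_space "\<Omega> (t n) n" using assms_sample n by auto
    note law = \<Omega>.distr_indep_vars_identical[of "borel" "Y (t n) n" "{1..n}" "\<gamma>s (t n)" "?V n" borel,
        OF assms_sample(2)[OF n] _ assms_sample(3)[OF n]]
    show ?case
      unfolding good_def
      using law n kernel_L3_dev_bound(2)[OF hm L3] U_stat_measurable[OF n(2)]
        \<Omega>.prob_space_axioms symmetric_kernel_axioms
      by (auto simp: U_stat_restrict third_moment_def simp del: One_nat_def)
  qed

  have "weak_conv_m (\<lambda>n. distr (\<Omega> (t n) n) borel (?W n)) (density lborel (normal_density 0 \<sigma>))"
    if "\<sigma> > 0"
  proof (rule levy_continuity_eventually)
    show "\<forall>\<^sub>F n in sequentially. real_distribution (distr (\<Omega> (t n) n) borel (?W n))"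
      using good unfolding good_def
      by (rule eventually_mono) (blast intro: prob_space.real_distribution_distr)
    show "real_distribution (density lborel (normal_density 0 \<sigma>))"
      using prob_space_normal_density[OF that] by (auto simp: real_distribution_def real_distribution_axioms_def)
    fix u :: real
    define bound where "bound n = \<bar>u\<bar> * (sqrt (18 * (1 + B ^ 3) / (real n - 1)) + \<bar>d n\<bar>)
      + (u\<^sup>2 * \<bar>v n - \<sigma>\<^sup>2\<bar> / 2 + 4 / 3 * \<bar>u\<bar> ^ 3 * B ^ 3 / sqrt n)" for n
    have "(\<lambda>n. 18 * (1 + B ^ 3) / (real n - 1)) \<longlonglongrightarrow> 0" by real_asymp
    from tendsto_real_sqrt[OF this]
    have "(\<lambda>n. sqrt (18 * (1 + B ^ 3) / (real n - 1))) \<longlonglongrightarrow> 0" by simp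
    moreover have "(\<lambda>n. 4 / 3 * \<bar>u\<bar> ^ 3 * B ^ 3 / sqrt (real n)) \<longlonglongrightarrow> 0" by real_asymp
    moreover have "(\<lambda>n. \<bar>d n\<bar>) \<longlonglongrightarrow> 0" using tendsto_rabs[OF d] by simp
    moreover have "(\<lambda>n. \<bar>v n - \<sigma>\<^sup>2\<bar>) \<longlonglongrightarrow> 0"
      using v by (intro tendsto_rabs_zero) (simp add: LIM_zero)
    ultimately have "bound \<longlonglongrightarrow> \<bar>u\<bar> * (0 + 0) + (u\<^sup>2 * 0 / 2 + 0)"
      unfolding bound_def by (intro tendsto_intros) auto
    then have bound: "bound \<longlonglongrightarrow> 0" by simp
    have "(\<lambda>n. u\<^sup>2 * \<sigma>\<^sup>2 / (2 * real n)) \<longlonglongrightarrow> 0" by real_asymp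
    then have "\<forall>\<^sub>F n in sequentially. u\<^sup>2 * \<sigma>\<^sup>2 / (2 * real n) < 2"
      by (rule order_tendstoD) simp
    with good have "\<forall>\<^sub>F n in sequentially. norm (char (distr (\<Omega> (t n) n) borel (?W n)) u
        - complex_of_real ((1 - u\<^sup>2 * \<sigma>\<^sup>2 / (2 * real n)) ^ n)) \<le> bound n"
    proof eventually_elim
      case (elim n)
      then interpret symmetric_kernel "\<gamma>s (t n)" h by (simp add: good_def)
      have n: "n \<ge> 2" and T: "third_moment \<le> B ^ 3"
        and eq: "distr (\<Omega> (t n) n) borel (?W n) = distr (?P n) borel (?V n)"
        using elim by (auto simp: good_def)
      have "norm (char (distr (\<Omega> (t n) n) borel (?W n)) u
          - complex_of_real ((1 - u\<^sup>2 * \<sigma>\<^sup>2 / (2 * real n)) ^ n))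
        \<le> \<bar>u\<bar> * (sqrt (18 * (1 + third_moment) / (real n - 1)) + \<bar>d n\<bar>)
          + (u\<^sup>2 * \<bar>v n - \<sigma>\<^sup>2\<bar> / 2 + 4 / 3 * \<bar>u\<bar> ^ 3 * third_moment / sqrt n)"
        unfolding eq d_def v_def using elim by (intro char_U_stat_le n) auto
      also have "\<dots> \<le> bound n"
        unfolding bound_def using T n
        by (intro add_mono mult_left_mono real_sqrt_le_mono divide_right_mono) auto
      finally show ?case .
    qed
    then have "(\<lambda>n. char (distr (\<Omega> (t n) n) borel (?W n)) u
        - complex_of_real ((1 - u\<^sup>2 * \<sigma>\<^sup>2 / (2 * real n)) ^ n)) \<longlonglongrightarrow> 0"
      using bound by (rule Lim_null_comparison)
    moreover have "(\<lambda>n. complex_of_real ((1 - u\<^sup>2 * \<sigma>\<^sup>2 / (2 * real n)) ^ n))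
        \<longlonglongrightarrow> complex_of_real (exp (- (\<sigma>\<^sup>2 * u\<^sup>2) / 2))"
      using tendsto_exp_limit_sequentially[of "- (\<sigma>\<^sup>2 * u\<^sup>2) / 2"]
      by (intro tendsto_of_real) (simp add: mult.commute)
    ultimately show "(\<lambda>n. char (distr (\<Omega> (t n) n) borel (?W n)) u)
        \<longlonglongrightarrow> char (density lborel (normal_density 0 \<sigma>)) u"
      unfolding char_normal_distribution[OF that] by (rule Lim_transform[rotated])
  qed
  moreover have "converges_in_prob (\<lambda>n. \<Omega> (t n) n) ?W 0" if "\<sigma> = 0"
    unfolding converges_in_prob_def
  proof (intro allI impI)
    fix \<epsilon> :: real
    assume \<epsilon>: "\<epsilon> > 0"
    define bound where "bound n = 3 * (v n + 18 * (1 + B ^ 3) / (real n - 1) + (d n)\<^sup>2) / \<epsilon>\<^sup>2" for n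
    have "(\<lambda>n. 18 * (1 + B ^ 3) / (real n - 1)) \<longlonglongrightarrow> 0" by real_asymp
    then have "bound \<longlonglongrightarrow> 3 * (\<sigma>\<^sup>2 + 0 + 0\<^sup>2) / \<epsilon>\<^sup>2"
      unfolding bound_def using d v \<epsilon> by (intro tendsto_intros) auto
    then have bound: "bound \<longlonglongrightarrow> 0" by (simp add: that)
    have "\<forall>\<^sub>F n in sequentially.
        norm (measure (\<Omega> (t n) n) {\<omega> \<in> space (\<Omega> (t n) n). \<bar>?W n \<omega> - 0\<bar> > \<epsilon>}) \<le> bound n"
      using good
    proof eventually_elim
      case (elim n)
      then interpret symmetric_kernel "\<gamma>s (t n)" h by (simp add: good_def)
      have n: "n \<ge> 2" and T: "third_moment \<le> B ^ 3" and W: "?W n \<in> borel_measurable (\<Omega> (t n) n)"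
        and eq: "distr (\<Omega> (t n) n) borel (?W n) = distr (?P n) borel (?V n)"
        using elim by (auto simp: good_def)
      interpret P: prob_space "?P n" by (rule prob_space_sample)
      note V = U_stat_measurable[OF n, of ?c]
      let ?A = "{r. \<epsilon> < \<bar>r\<bar>} :: real set"
      have A: "?A \<in> sets borel" by measurable
      have "measure (\<Omega> (t n) n) {\<omega> \<in> space (\<Omega> (t n) n). \<bar>?W n \<omega> - 0\<bar> > \<epsilon>}
          = measure (distr (\<Omega> (t n) n) borel (?W n)) ?A"
        by (subst measure_distr[OF W A]) (auto intro!: arg_cong[where f="measure _"])
      also have "\<dots> = measure (?P n) (?V n -` ?A \<inter> space (?P n))"
        unfolding eq by (rule measure_distr[OF V A])
      also have "\<dots> \<le> measure (?P n) {x \<in> space (?P n). \<bar>?V n x\<bar> \<ge> \<epsilon>}"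
        using V by (intro P.finite_measure_mono) auto
      also have "\<dots> \<le> 3 * (v n + 18 * (1 + third_moment) / (real n - 1) + (d n)\<^sup>2) / \<epsilon>\<^sup>2"
        unfolding v_def d_def by (rule prob_U_stat_le[OF n \<epsilon>])
      also have "\<dots> \<le> bound n"
        unfolding bound_def using T n by (intro divide_right_mono mult_left_mono add_mono) auto
      finally show ?case by simp
    qed
    then show "(\<lambda>n. measure (\<Omega> (t n) n) {\<omega> \<in> space (\<Omega> (t n) n). \<bar>?W n \<omega> - 0\<bar> > \<epsilon>}) \<longlonglongrightarrow> 0"
      using bound by (rule Lim_null_comparison)
  qed
  ultimately show ?thesis by blast
qed

end
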